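(* Let $A\in\mathbb{R}^{n\times n}$. Then $A$ is stable if and only if there exist $S,U,B\in\mathbb{R}^{n\times n}$ such that $S$ is invertible, $U^TU=I_n$, $B$ is symmetric positive semidefinite, $\|B\|\le 1$, and $A=S^{-1}UBS$.
   Context: A real square matrix is called stable if all its eigenvalues lie in the closed unit disk $\{z\in\mathbb{C}:|z|\le 1\}$ and those eigenvalues on the unit circle are semisimple (algebraic multiplicity equals geometric multiplicity). $\|\cdot\|$ denotes the spectral norm and $I_n$ the $n\times n$ identity matrix. *)

theory Defs
  imports "HOL-Analysis.Analysis" "HOL-Computational_Algebra.Polynomial"
begin

definition cmat :: "real^'n^'n \<Rightarrow> complex^'n^'n" where
  "cmat A = (\<chi> i j. complex_of_real (A $ i $ j))"

definition char_poly_c :: "real^'n^'n \<Rightarrow> complex poly" where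
  "char_poly_c A = det (\<chi> i j. (if i = j then [:0, 1:] else 0) - [:cmat A $ i $ j:])"

definition is_eigenvalue :: "real^'n^'n \<Rightarrow> complex \<Rightarrow> bool" where
  "is_eigenvalue A z \<longleftrightarrow> (\<exists>v. v \<noteq> 0 \<and> cmat A *v v = z *s v)"

definition alg_mult :: "real^'n^'n \<Rightarrow> complex \<Rightarrow> nat" where
  "alg_mult A z = order z (char_poly_c A)"

definition geom_mult :: "real^'n^'n \<Rightarrow> complex \<Rightarrow> nat" where
  "geom_mult A z = vec.dim {v. cmat A *v v = z *s v}"

definition stable :: "real^'n^'n \<Rightarrow> bool" where
  "stable A \<longleftrightarrow> (\<forall>z. is_eigenvalue A z \<longrightarrow>
      cmod z \<le> 1 \<and> (cmod z = 1 \<longrightarrow> alg_mult A z = geom_mult A z))"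

definition spec_norm :: "real^'n^'n \<Rightarrow> real" where
  "spec_norm B = onorm (\<lambda>x. B *v x)"

end

theory Submission
  imports Defs
    "HOL-Computational_Algebra.Fundamental_Theorem_Algebra"
begin

text \<open>
  By the polar decomposition, the right-hand side says that \<open>A\<close> is similar over the reals to a
  contraction for the Euclidean norm, so the question is whether \<open>A\<close> contracts some norm
  \<open>x \<mapsto> \<parallel>S x\<parallel>\<close>.
  If it does, all powers of \<open>A\<close> are bounded; this bounds the eigenvalues by 1 and excludes
  generalized eigenvectors at unimodular eigenvalues, where \<open>A\<^sup>k w = z\<^sup>k w + k z\<^sup>k\<^sup>-\<^sup>1 u\<close> would grow linearly.
  Conversely, a complex contracted norm is built one dimension at a time along a flag of invariant
  subspaces: an invariant hyperplane is complemented orthogonally by a direction of large weight, or,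
  as long as a unimodular eigenvalue is left, by one of its eigenvectors.
  Restricted to real vectors this norm is Euclidean and hence isometric to the standard one.
\<close>

subsection \<open>Polar decomposition\<close>

definition outer :: "'a::times^'n \<Rightarrow> 'a^'m \<Rightarrow> 'a^'m^'n" where
  "outer u v = (\<chi> i j. u $ i * v $ j)"

lemma outer_mult_vec: "outer u v *v x = ((v::real^'m) \<bullet> x) *\<^sub>R (u::real^'n)"
  by (simp add: outer_def matrix_vector_mult_def vec_eq_iff inner_vec_def sum_distrib_left mult_ac)

lemma inner_outer: "outer u v \<bullet> (B::real^'m^'n) = u \<bullet> (B *v v)"
  by (simp add: outer_def inner_vec_def matrix_vector_mult_def sum_distrib_left mult_ac)

text \<open>The inner product of matrices is the Frobenius one, for which left multiplication by
  \<open>U\<close> has left multiplication by \<open>transpose U\<close> as its adjoint.\<close>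

lemma inner_matrix_mult: "(U ** Q) \<bullet> C = Q \<bullet> (transpose U ** (C :: real^'m^'n))"
  for U :: "real^'k^'n" and Q :: "real^'m^'k"
proof -
  have "(U ** Q) \<bullet> C = (\<Sum>i\<in>UNIV. \<Sum>j\<in>UNIV. \<Sum>k\<in>UNIV. U$i$k * Q$k$j * C$i$j)"
    by (simp add: inner_vec_def matrix_matrix_mult_def sum_distrib_right)
  also have "\<dots> = (\<Sum>k\<in>UNIV. \<Sum>j\<in>UNIV. \<Sum>i\<in>UNIV. U$i$k * Q$k$j * C$i$j)"
    by (subst sum.swap, subst (2) sum.swap, subst sum.swap) simp
  also have "\<dots> = Q \<bullet> (transpose U ** C)"
    by (simp add: inner_vec_def matrix_matrix_mult_def transpose_def sum_distrib_left mult_ac)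
  finally show ?thesis .
qed

text \<open>At \<open>v = 0\<close> the convention \<open>x / 0 = 0\<close> makes this the identity,
  which is orthogonal as well.\<close>

definition reflection :: "real^'n \<Rightarrow> real^'n^'n" where
  "reflection v = mat 1 - (2 / (v \<bullet> v)) *\<^sub>R outer v v"

lemma reflection_mult_vec: "reflection v *v x = x - (2 * (v \<bullet> x) / (v \<bullet> v)) *\<^sub>R v"
  by (simp add: reflection_def matrix_vector_mult_diff_rdistrib outer_mult_vec
      scaleR_matrix_vector_assoc[symmetric])

lemma orthogonal_matrix_reflection: "orthogonal_matrix (reflection v)"
proof -
  have "transpose (reflection v) = reflection v"
    by (simp add: reflection_def vec_eq_iff transpose_def outer_def mat_def)
  moreover have "reflection v ** reflection v = mat 1"
    by (simp add: matrix_eq matrix_vector_mul_assoc[symmetric] reflection_mult_vec inner_diff_right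
        vec_eq_iff field_simps)
  ultimately show ?thesis by (simp add: orthogonal_matrix)
qed

lemma inner_reflection: "reflection v \<bullet> B = mat 1 \<bullet> B - 2 * (v \<bullet> (B *v v)) / (v \<bullet> v)"
  by (simp add: reflection_def inner_diff_left inner_outer)

lemma reflection_mult:
  "reflection u ** reflection v = mat 1 - (2 / (u \<bullet> u)) *\<^sub>R outer u u - (2 / (v \<bullet> v)) *\<^sub>R outer v v
    + (4 * (u \<bullet> v) / ((u \<bullet> u) * (v \<bullet> v))) *\<^sub>R outer u v"
  by (simp add: matrix_eq matrix_vector_mul_assoc[symmetric] reflection_mult_vec inner_diff_right
        matrix_vector_mult_diff_rdistrib matrix_vector_mult_add_rdistrib outer_mult_vec
        scaleR_matrix_vector_assoc[symmetric] algebra_simps)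

text \<open>Divide by \<open>t\<close> and let it tend to 0. This extracts the first-order term from
  a comparison with a small perturbation.\<close>

lemma le_zero_if_le_quadratic:
  fixes p K :: real
  assumes "\<And>t. t > 0 \<Longrightarrow> t * p \<le> t\<^sup>2 * K"
  shows "p \<le> 0"
proof (rule ccontr)
  assume "\<not> p \<le> 0"
  then have p: "p > 0" by simp
  \<comment> \<open>Makes \<open>t * K\<close> at most \<open>p / 2\<close>; the summand 1 keeps the
    denominator positive when \<open>K = 0\<close>.\<close>
  define t where "t = p / (2 * (\<bar>K\<bar> + 1))"
  have t: "t > 0" using p by (simp add: t_def)
  have "p \<le> t * K" using assms[OF t] t by (simp add: power2_eq_square)
  also have "\<dots> \<le> t * (\<bar>K\<bar> + 1)" using t by (intro mult_left_mono) auto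
  also have "\<dots> = p / 2" by (simp add: t_def field_simps)
  finally show False using p by simp
qed

text \<open>Closed because it is cut out by a continuous equation, bounded because all rows are unit
  vectors. Compactness provides the maximizer in the polar decomposition.\<close>

lemma compact_orthogonal_matrices: "compact {U :: real^'n^'n. orthogonal_matrix U}"
proof -
  have "closed {U :: real^'n^'n. transpose U ** U = mat 1}"
    unfolding transpose_def matrix_matrix_mult_def
    by (intro closed_Collect_eq continuous_intros)
  moreover have "norm U \<le> real CARD('n)" if "orthogonal_matrix U" for U :: "real^'n^'n"
  proof -
    have "norm (U $ i) = 1" for i
      using that by (simp add: orthogonal_matrix_orthonormal_rows row_def vec_lambda_eta)
    moreover have "norm U \<le> (\<Sum>i\<in>UNIV. norm (U $ i))"
      unfolding norm_vec_def by (rule L2_set_le_sum) simp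
    ultimately show ?thesis by simp
  qed
  ultimately show ?thesis
    unfolding compact_eq_bounded_closed bounded_iff orthogonal_matrix by auto
qed

text \<open>
  The orthogonal \<open>U\<close> maximizing \<open>trace (U\<^sup>T C)\<close>, which is the inner product of \<open>U\<close> and \<open>C\<close>, is the
  polar factor. For \<open>B = U\<^sup>T C\<close>, comparing \<open>U\<close> with \<open>U R\<close> for a reflection \<open>R\<close> shows that \<open>B\<close> is
  positive semidefinite; a product of two reflections close to each other shows that it is symmetric.
\<close>

lemma polar_decomposition:
  fixes C :: "real^'n^'n"
  obtains U B where "orthogonal_matrix U" "transpose B = B" "\<And>x. 0 \<le> x \<bullet> (B *v x)" "C = U ** B"
proof -
  have "{U :: real^'n^'n. orthogonal_matrix U} \<noteq> {}" using orthogonal_matrix_id by auto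
  moreover have "continuous_on {U. orthogonal_matrix U} (\<lambda>U. U \<bullet> C)"
    by (intro continuous_intros)
  ultimately obtain U where U: "orthogonal_matrix U"
    and max: "\<And>V. orthogonal_matrix V \<Longrightarrow> V \<bullet> C \<le> U \<bullet> C"
    using continuous_attains_sup[OF compact_orthogonal_matrices] by (smt (verit) mem_Collect_eq)
  define B where "B = transpose U ** C"
  \<comment> \<open>Compare \<open>U\<close> with \<open>U ** Q\<close> and move \<open>U\<close>
    across the inner product: the identity is then a maximizer for \<open>B\<close>.\<close>
  have maxB: "Q \<bullet> B \<le> mat 1 \<bullet> B" if "orthogonal_matrix Q" for Q
    using max[OF orthogonal_matrix_mul[OF U that]] inner_matrix_mult[of U "mat 1" C]
    by (simp add: inner_matrix_mult B_def)
  have C: "C = U ** B"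
    using U by (simp add: B_def matrix_mul_assoc orthogonal_matrix_def)
  have pos: "0 \<le> x \<bullet> (B *v x)" for x
  proof (cases "x = 0")
    case False
    then have "x \<bullet> x > 0" by simp
    moreover have "0 \<le> 2 * (x \<bullet> (B *v x)) / (x \<bullet> x)"
      using maxB[OF orthogonal_matrix_reflection[of x]] by (simp add: inner_reflection)
    ultimately show ?thesis
      using divide_neg_pos[of "2 * (x \<bullet> (B *v x))" "x \<bullet> x"] by linarith
  qed simp
  have le: "u \<bullet> (B *v w) \<le> w \<bullet> (B *v u)" if u: "u \<bullet> u = 1" and w: "w \<bullet> w = 1" and uw: "u \<bullet> w = 0" for u w
  proof -
    have quad: "t * (u \<bullet> (B *v w) - w \<bullet> (B *v u)) \<le> t\<^sup>2 * (u \<bullet> (B *v u) + w \<bullet> (B *v w))" for t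
    proof -
      \<comment> \<open>The product of the reflections in \<open>u\<close> and \<open>v\<close> is a
        rotation in the plane of \<open>u\<close> and \<open>w\<close> that tends to the identity
        with \<open>t\<close>. The terms of order 0 cancel, and those linear in \<open>t\<close>
        leave the antisymmetric part of \<open>B\<close>.\<close>
      define v where "v = u + t *\<^sub>R w"
      have vv: "v \<bullet> v = 1 + t\<^sup>2" and uv: "u \<bullet> v = 1"
        using u w uw by (auto simp: v_def inner_add_left inner_add_right inner_commute power2_eq_square)
      have uB: "u \<bullet> (B *v v) = u \<bullet> (B *v u) + t * (u \<bullet> (B *v w))"
        by (simp add: v_def matrix_vector_right_distrib inner_add_right matrix_vector_mult_scaleR)
      have vB: "v \<bullet> (B *v v) = u \<bullet> (B *v u) + t * (u \<bullet> (B *v w)) + t * (w \<bullet> (B *v u)) + t\<^sup>2 * (w \<bullet> (B *v w))"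
        by (simp add: v_def matrix_vector_right_distrib inner_add_left inner_add_right matrix_vector_mult_scaleR power2_eq_square algebra_simps)
      have clear: "X / P \<le> Y + Z / P \<Longrightarrow> X \<le> Y * P + Z" if "P > 0" for X Y Z P :: real
        using that by (simp add: field_simps)
      have pos: "1 + t\<^sup>2 > 0" by (simp add: add_pos_nonneg)
      have "4 * (u \<bullet> (B *v v)) / (1 + t\<^sup>2) \<le> 2 * (u \<bullet> (B *v u)) + 2 * (v \<bullet> (B *v v)) / (1 + t\<^sup>2)"
        using maxB[OF orthogonal_matrix_mul[OF orthogonal_matrix_reflection[of u] orthogonal_matrix_reflection[of v]]]
        by (simp add: reflection_mult inner_diff_left inner_add_left inner_outer u uv vv)
      then have "4 * (u \<bullet> (B *v v)) \<le> 2 * (u \<bullet> (B *v u)) * (1 + t\<^sup>2) + 2 * (v \<bullet> (B *v v))"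
        by (rule clear[OF pos])
      then show ?thesis unfolding uB vB by (simp add: algebra_simps)
    qed
    have "u \<bullet> (B *v w) - w \<bullet> (B *v u) \<le> 0"
      by (rule le_zero_if_le_quadratic[OF quad])
    then show ?thesis by simp
  qed
  have entry: "axis i 1 \<bullet> (B *v axis j 1) = B $ i $ j" for i j
    by (simp add: inner_axis' matrix_vector_mult_basis column_def)
  have "B $ i $ j \<le> B $ j $ i" for i j
    using le[of "axis i 1" "axis j 1"] by (cases "i = j") (simp_all add: entry inner_axis_axis)
  then have "transpose B = B"
    by (simp add: transpose_def vec_eq_iff order_antisym)
  then show ?thesis using that U pos C by blast
qed

subsection \<open>Eigenvectors in invariant subspaces\<close>

text \<open>\<open>p(M) v\<close>, by Horner's scheme\<close>

definition poly_mat_vec :: "'a::field^'n^'n \<Rightarrow> 'a^'n \<Rightarrow> 'a poly \<Rightarrow> 'a^'n" where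
  "poly_mat_vec M v p = fold_coeffs (\<lambda>a y. a *s v + M *v y) p 0"

lemma poly_mat_vec_0 [simp]: "poly_mat_vec M v 0 = 0"
  by (simp add: poly_mat_vec_def)

lemma poly_mat_vec_pCons [simp]:
  "poly_mat_vec M v (pCons a p) = a *s v + M *v poly_mat_vec M v p"
  by (cases "p = 0"; cases "a = 0") (simp_all add: poly_mat_vec_def)

lemma poly_mat_vec_add: "poly_mat_vec M v (p + q) = poly_mat_vec M v p + poly_mat_vec M v q"
  by (induction p q rule: poly_induct2)
    (simp_all add: vec.scale_left_distrib matrix_vector_right_distrib algebra_simps)

lemma poly_mat_vec_smult: "poly_mat_vec M v (smult c p) = c *s poly_mat_vec M v p"
  by (induction p) (simp_all add: vec.scale_right_distrib vec.scale)

lemma poly_mat_vec_monom: "poly_mat_vec M v (monom 1 k) = (((*v) M) ^^ k) v"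
  by (induction k) (simp_all add: monom_0 monom_Suc)

lemma poly_mat_vec_in_subspace:
  assumes "vec.subspace V" "v \<in> V" "\<And>x. x \<in> V \<Longrightarrow> M *v x \<in> V"
  shows "poly_mat_vec M v p \<in> V"
  by (induction p) (simp_all add: assms vec.subspace_0 vec.subspace_add vec.subspace_scale)

text \<open>Otherwise the iterates of \<open>v\<close> under \<open>M\<close> would all be
  independent, and one more than the dimension of them gives a contradiction.\<close>

lemma ex_annihilating_poly:
  fixes M :: "'a::field^'n^'n"
  shows "\<exists>p. p \<noteq> 0 \<and> poly_mat_vec M v p = 0"
proof (rule ccontr)
  assume no: "\<not> ?thesis"
  let ?f = "\<lambda>k. (((*v) M) ^^ k) v"
  \<comment> \<open>The cardinality excludes repetitions among the iterates, which the image set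
    would hide.\<close>
  have "vec.independent (?f ` {..<d}) \<and> card (?f ` {..<d}) = d" for d
  proof (induction d)
    case (Suc d)
    \<comment> \<open>The alternative \<open>p = 0\<close> matters for \<open>d = 0\<close>, where
      no degree is below \<open>d\<close>.\<close>
    have "vec.span (?f ` {..<d}) \<subseteq> {poly_mat_vec M v p | p. p = 0 \<or> degree p < d}"
    proof (rule vec.span_minimal)
      show "?f ` {..<d} \<subseteq> {poly_mat_vec M v p | p. p = 0 \<or> degree p < d}"
      proof (rule image_subsetI)
        fix k assume "k \<in> {..<d}"
        then have "degree (monom (1::'a) k) < d" by (simp add: degree_monom_eq)
        then show "?f k \<in> {poly_mat_vec M v p | p. p = 0 \<or> degree p < d}"
          using poly_mat_vec_monom[of M v k] by (metis (mono_tags, lifting) mem_Collect_eq)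
      qed
      show "vec.subspace {poly_mat_vec M v p | p. p = 0 \<or> degree p < d}"
        unfolding vec.subspace_def
      proof (intro conjI ballI allI)
        fix x y assume "x \<in> {poly_mat_vec M v p | p. p = 0 \<or> degree p < d}"
          "y \<in> {poly_mat_vec M v p | p. p = 0 \<or> degree p < d}"
        then obtain p q where "x = poly_mat_vec M v p" "y = poly_mat_vec M v q"
          and d: "p = 0 \<or> degree p < d" "q = 0 \<or> degree q < d" by blast
        then have "x + y = poly_mat_vec M v (p + q)" by (simp only: poly_mat_vec_add)
        moreover have "p + q = 0 \<or> degree (p + q) < d"
          using d degree_add_less by auto
        ultimately show "x + y \<in> {poly_mat_vec M v p | p. p = 0 \<or> degree p < d}"
          by blast
      next
        fix c x assume "x \<in> {poly_mat_vec M v p | p. p = 0 \<or> degree p < d}"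
        then obtain p where "x = poly_mat_vec M v p" and d: "p = 0 \<or> degree p < d" by blast
        then have "c *s x = poly_mat_vec M v (smult c p)" by (simp only: poly_mat_vec_smult)
        moreover have "smult c p = 0 \<or> degree (smult c p) < d"
          using d degree_smult_le[of c p] by auto
        ultimately show "c *s x \<in> {poly_mat_vec M v p | p. p = 0 \<or> degree p < d}"
          by blast
      qed (auto intro!: exI[of _ 0])
    qed
    moreover have "?f d \<noteq> poly_mat_vec M v p" if "p = 0 \<or> degree p < d" for p
    proof
      assume "?f d = poly_mat_vec M v p"
      then have "poly_mat_vec M v (p + smult (-1) (monom 1 d)) = 0"
        by (simp only: poly_mat_vec_add poly_mat_vec_smult poly_mat_vec_monom) simp
      with no have "p + smult (-1) (monom 1 d) = 0" by blast
      then have "p = monom 1 d" by simp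
      with that show False by (auto simp: degree_monom_eq)
    qed
    ultimately have "?f d \<notin> vec.span (?f ` {..<d})" by blast
    moreover from this have "?f d \<notin> ?f ` {..<d}"
      by (rule contrapos_nn) (erule vec.span_base)
    moreover have "?f ` {..<Suc d} = insert (?f d) (?f ` {..<d})"
      by (simp only: lessThan_Suc image_insert)
    ultimately show ?case
      using Suc by (simp only: vec.independent_insert card_insert_disjoint finite_imageI finite_lessThan)
        simp
  qed (simp add: vec.independent_empty)
  then have "Suc (CARD('n)) \<le> vec.dim (UNIV :: ('a^'n) set)"
    using vec.independent_card_le_dim[OF subset_UNIV] by metis
  then show False by (simp add: card_cart_basis)
qed

text \<open>Split a root \<mu> off an annihilating polynomial of some nonzero \<open>v\<close> in
  \<open>V\<close>. The remaining factor \<open>q\<close> either annihilates \<open>v\<close> with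
  smaller degree, or \<open>poly_mat_vec M v q\<close> is an eigenvector for \<mu>; it lies in
  \<open>V\<close> by invariance.\<close>

lemma ex_eigenvector_in_subspace:
  fixes M :: "complex^'n^'n"
  assumes V: "vec.subspace V" "\<And>x. x \<in> V \<Longrightarrow> M *v x \<in> V" and "V \<noteq> {0}"
  obtains \<mu> w where "w \<in> V" "w \<noteq> 0" "M *v w = \<mu> *s w"
proof -
  obtain v where v: "v \<in> V" "v \<noteq> 0" using assms vec.subspace_0 by blast
  obtain p0 where "p0 \<noteq> 0" "poly_mat_vec M v p0 = 0" using ex_annihilating_poly by blast
  then have "\<exists>\<mu> w. w \<in> V \<and> w \<noteq> 0 \<and> M *v w = \<mu> *s w"
  proof (induction "degree p0" arbitrary: p0 rule: less_induct)
    case less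
    show ?case
    proof (cases "degree p0 = 0")
      case True
      then obtain a where "p0 = [:a:]" by (metis degree_eq_zeroE)
      with less v show ?thesis by simp
    next
      case False
      then obtain \<mu> where "poly p0 \<mu> = 0"
        using fundamental_theorem_of_algebra by (metis constant_degree)
      then obtain q where q: "p0 = [:-\<mu>, 1:] * q" by (metis poly_eq_0_iff_dvd dvdE)
      have "q \<noteq> 0" using less q by auto
      have "p0 = smult (-\<mu>) q + pCons 0 q" using q by simp
      then have "poly_mat_vec M v p0 = - \<mu> *s poly_mat_vec M v q + M *v poly_mat_vec M v q"
        by (simp only: poly_mat_vec_add poly_mat_vec_smult poly_mat_vec_pCons) simp
      with less have eig: "M *v poly_mat_vec M v q = \<mu> *s poly_mat_vec M v q"
        by (simp only: vec.scale_minus_left) (simp add: add_eq_0_iff)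
      show ?thesis
      proof (cases "poly_mat_vec M v q = 0")
        case True
        moreover have "degree p0 = degree [:-\<mu>, 1:] + degree q"
          unfolding q by (rule degree_mult_eq) (use \<open>q \<noteq> 0\<close> in auto)
        then have "degree q < degree p0" by simp
        ultimately show ?thesis using less \<open>q \<noteq> 0\<close> by blast
      next
        case False
        then show ?thesis
          using eig poly_mat_vec_in_subspace[OF V(1) v(1) V(2)] by blast
      qed
    qed
  qed
  then show ?thesis using that by blast
qed

section \<open>Complex scaling, orthogonality and linear functionals\<close>

lemma norm_vector_scalar_mult: "norm (c *s v) = cmod c * norm v" for v :: "complex^'n"
  by (simp add: norm_vec_def norm_mult L2_set_right_distrib)

lemma of_real_vector_scalar_mult: "complex_of_real r *s x = r *\<^sub>R x" for x :: "complex^'n"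
  unfolding vec_eq_iff vector_smult_component vector_scaleR_component
  by (simp add: scaleR_conv_of_real)

text \<open>The inner product here is the real one. Since scaling by \<open>d\<close> has scaling by
  \<open>cnj d\<close> as its adjoint and \<open>S\<close> is closed under complex scaling, a vector
  orthogonal to \<open>S\<close> in the real sense stays so after complex scaling.\<close>

lemma orthogonal_to_complex_subspace:
  fixes S :: "(complex^'n) set"
  assumes S: "vec.subspace S" and "S \<noteq> UNIV"
  obtains e where "norm e = 1" "\<And>c y. y \<in> S \<Longrightarrow> orthogonal (c *s e) y"
proof -
  have "subspace S"
    using S unfolding subspace_def vec.subspace_def by (auto simp flip: of_real_vector_scalar_mult)
  then have sp: "span S = S" by (simp add: span_eq_iff)
  then have "span S \<subset> span UNIV" using \<open>S \<noteq> UNIV\<close> by (metis psubsetI span_UNIV subset_UNIV)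
  then obtain x where x: "x \<noteq> 0" "\<And>y. y \<in> S \<Longrightarrow> orthogonal x y"
    using orthogonal_to_subspace_exists_gen[of S UNIV] sp by metis
  define e where "e = complex_of_real (1 / norm x) *s x"
  have "norm e = 1" using x by (simp add: e_def norm_vector_scalar_mult norm_divide)
  moreover have "orthogonal (c *s e) y" if "y \<in> S" for c y
  proof -
    have adj: "inner (d *s z) w = inner z (cnj d *s w)" for d and z w :: "complex^'n"
      by (simp add: inner_vec_def inner_complex_def algebra_simps)
    have "cnj (c * complex_of_real (1 / norm x)) *s y \<in> S"
      using S that by (rule vec.subspace_scale)
    then show ?thesis
      using x(2) by (simp add: orthogonal_def e_def adj)
  qed
  ultimately show ?thesis using that by blast
qed

lemma ex_linear_functional:
  fixes R :: "('a::field^'n) set"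
  assumes R: "vec.subspace R" and v: "v \<notin> R"
  obtains c :: "'a^'n \<Rightarrow> 'a" where "Vector_Spaces.linear (*s) (*) c" "c v = 1" "\<And>x. x \<in> R \<Longrightarrow> c x = 0"
proof -
  obtain B where B: "B \<subseteq> R" "vec.independent B" "R \<subseteq> vec.span B"
    by (rule vec.basis_exists[of R])
  have "v \<notin> vec.span B" using vec.span_minimal[OF B(1) R] v by blast
  then have "vec.independent (insert v B)" using B by (simp add: vec.independent_insert)
  \<comment> \<open>The extension takes values on a single coordinate axis, at the arbitrary index
    \<open>undefined\<close>; reading off that coordinate gives the functional.\<close>
  obtain h where h: "Vector_Spaces.linear (*s) (*s) h"
    "\<forall>x\<in>insert v B. h x = (if x = v then axis undefined 1 else (0 :: 'a^'n))"
    using vec.linear_independent_extend[OF \<open>vec.independent (insert v B)\<close>,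
        of "\<lambda>x. if x = v then axis undefined 1 else (0 :: 'a^'n)"] by blast
  interpret h: Vector_Spaces.linear "(*s)" "(*s)" h by fact
  define c where "c = (\<lambda>x. h x $ undefined)"
  have "Vector_Spaces.linear (*s) (*) c"
    by (unfold_locales) (simp_all add: c_def h.add h.scale algebra_simps)
  moreover have "c v = 1" using h by (simp add: c_def)
  moreover have "c x = 0" if "x \<in> R" for x
  proof -
    have "h x = 0" if "x \<in> vec.span B" for x
      using that
    proof (rule vec.span_induct)
      show "vec.subspace {x. h x = 0}" by (rule h.subspace_kernel)
      show "h b = 0" if "b \<in> B" for b using h(2) that B(1) v by auto
    qed
    with that B(3) show ?thesis by (auto simp: c_def)
  qed
  ultimately show ?thesis using that by blast
qed

subsection \<open>Contracted norms\<close>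

lemma linear_vec_id: "Vector_Spaces.linear (*s) (*s) (id :: 'a::field^'n \<Rightarrow> 'a^'n)"
  by unfold_locales (simp_all add: algebra_simps)

lemma linear_mat_vec_minus_scalar_mult:
  "Vector_Spaces.linear (*s) (*s) (\<lambda>x. M *v x - \<mu> *s x)" for M :: "'a::field^'n^'n"
  by unfold_locales (simp_all add: matrix_vector_right_distrib vec.scale_right_distrib
      vec.scale vec.scale_right_diff_distrib algebra_simps)

text \<open>Rank-nullity: in a basis of \<open>V\<close> containing \<open>w\<close>, the image is
  already spanned by the images of the other basis vectors.\<close>

lemma image_proper_of_kernel:
  assumes V: "vec.subspace V" and f: "Vector_Spaces.linear (*s) (*s) f"
    and w: "w \<in> V" "w \<noteq> 0" "f w = 0"
  shows "f ` V \<noteq> (V :: ('a::field^'n) set)"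
proof
  assume eq: "f ` V = V"
  interpret f: Vector_Spaces.linear "(*s)" "(*s)" f by fact
  obtain B where B: "{w} \<subseteq> B" "B \<subseteq> V" "vec.independent B" "V \<subseteq> vec.span B"
    using vec.maximal_independent_subset_extend[of "{w}" V] w by auto
  have fin: "finite B" using B(3) by (rule vec.finiteI_independent)
  have "V = f ` V" using eq ..
  also have "\<dots> \<subseteq> f ` vec.span B" using B(4) by (rule image_mono)
  also have "\<dots> = vec.span (f ` B)" by (simp add: f.span_image)
  also have "\<dots> \<subseteq> vec.span (insert 0 (f ` (B - {w})))"
    by (rule vec.span_mono) (use w(3) in auto)
  also have "\<dots> = vec.span (f ` (B - {w}))" by (rule vec.span_insert_0)
  finally have "vec.dim V \<le> card (f ` (B - {w}))" using fin by (intro vec.dim_le_card) auto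
  also have "\<dots> \<le> card (B - {w})" using fin by (intro card_image_le) auto
  also have "\<dots> < card B" using fin B(1) by (intro card_Diff1_less) auto
  also have "card B = vec.dim V" using B by (intro vec.basis_card_eq_dim) auto
  finally show False by simp
qed


text \<open>Along the splitting of the space into the kernel of \<open>c\<close> and the line of
  \<open>v\<close>, keep \<open>T\<close> on the kernel and send \<open>v\<close> to
  \<open>K\<close> times a unit vector \<open>e\<close> orthogonal to the image of the kernel. Thus
  \<open>K\<close> is the weight of the direction \<open>v\<close>.\<close>

lemma extend_norm_from_hyperplane:
  fixes T :: "complex^'n \<Rightarrow> complex^'n" and K :: real
  assumes T: "Vector_Spaces.linear (*s) (*s) T" "inj T"
    and c: "Vector_Spaces.linear (*s) (*) c" "c v = 1" and K: "K > 0"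
  obtains T' :: "complex^'n \<Rightarrow> complex^'n" where "Vector_Spaces.linear (*s) (*s) T'" "inj T'"
    "\<And>x. (norm (T' x))\<^sup>2 = (norm (T (x - c x *s v)))\<^sup>2 + K\<^sup>2 * (cmod (c x))\<^sup>2"
proof -
  interpret T: Vector_Spaces.linear "(*s)" "(*s)" T by fact
  interpret c: Vector_Spaces.linear "(*s)" "(*)" c by fact
  let ?S = "T ` {x. c x = 0}"
  have "vec.subspace {x. c x = 0}" by (rule c.subspace_kernel)
  then have S: "vec.subspace ?S" by (rule T.subspace_image)
  have "T v \<notin> ?S" 
  proof
    assume "T v \<in> ?S"
    then obtain y where "c y = 0" "T v = T y" by blast
    with T(2) c(2) show False using injD by fastforce
  qed
  then have "?S \<noteq> UNIV" by blast
  then obtain e where e: "norm e = 1" "\<And>c y. y \<in> ?S \<Longrightarrow> orthogonal (c *s e) y"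
    using orthogonal_to_complex_subspace[OF S] by metis
  define T' :: "complex^'n \<Rightarrow> complex^'n" where "T' x = T (x - c x *s v) + (of_real K * c x) *s e" for x
  have sq: "(norm (T' x))\<^sup>2 = (norm (T (x - c x *s v)))\<^sup>2 + K\<^sup>2 * (cmod (c x))\<^sup>2" for x
  proof -
    have "c (x - c x *s v) = 0" by (simp add: c.diff c.scale c(2))
    then have "T (x - c x *s v) \<in> ?S" by blast
    then have "orthogonal (T (x - c x *s v)) ((of_real K * c x) *s e)"
      by (subst orthogonal_commute) (rule e(2))
    then have "(norm (T' x))\<^sup>2 = (norm (T (x - c x *s v)))\<^sup>2 + (norm ((of_real K * c x) *s e))\<^sup>2"
      unfolding T'_def by (rule norm_add_Pythagorean)
    then show ?thesis using K e(1)
      by (simp add: norm_vector_scalar_mult norm_mult power_mult_distrib)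
  qed
  have lin: "Vector_Spaces.linear (*s) (*s) T'"
    by unfold_locales
      (simp_all add: T'_def c.add c.scale T.add T.diff T.scale vec.scale_right_distrib
        vec.scale_left_distrib vec.scale_right_diff_distrib algebra_simps)
  then interpret T': Vector_Spaces.linear "(*s)" "(*s)" T' .
  have "x = 0" if "T' x = 0" for x
  proof -
    have "(norm (T (x - c x *s v)))\<^sup>2 + K\<^sup>2 * (cmod (c x))\<^sup>2 = 0" using sq[of x] that by simp
    then have "(norm (T (x - c x *s v)))\<^sup>2 = 0" "K\<^sup>2 * (cmod (c x))\<^sup>2 = 0"
      by (simp_all add: add_nonneg_eq_0_iff)
    then have "T (x - c x *s v) = 0" "c x = 0" using K by auto
    then have "T x = T 0" by simp
    with T(2) show ?thesis by (rule injD)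
  qed
  then have "inj T'" by (simp add: T'.inj_iff_eq_0)
  then show ?thesis by (rule that[OF lin _ sq])
qed

text \<open>A functional that vanishes on the image of \<open>V\<close> under \<open>M\<close> minus
  \<mu> is a left eigenvector of \<open>M\<close> on \<open>V\<close>, so its kernel is invariant.
  It can be normalized at \<open>v\<close> because \<open>v\<close> is outside that image.\<close>

lemma invariant_hyperplane:
  fixes M :: "'a::field^'n^'n"
  assumes V: "vec.subspace V" "\<And>x. x \<in> V \<Longrightarrow> M *v x \<in> V"
    and v: "v \<in> V" "v \<notin> (\<lambda>x. M *v x - \<mu> *s x) ` V"
  obtains c :: "'a^'n \<Rightarrow> 'a" where "Vector_Spaces.linear (*s) (*) c" "c v = 1"
    "\<And>x. x \<in> V \<Longrightarrow> c (M *v x) = \<mu> * c x"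
    "vec.subspace (V \<inter> {x. c x = 0})" "vec.dim (V \<inter> {x. c x = 0}) < vec.dim V"
    "\<And>x. x \<in> V \<inter> {x. c x = 0} \<Longrightarrow> M *v x \<in> V \<inter> {x. c x = 0}"
proof -
  let ?f = "\<lambda>x. M *v x - \<mu> *s x"
  have f: "Vector_Spaces.linear (*s) (*s) ?f"
    by (rule linear_mat_vec_minus_scalar_mult)
  then interpret f: Vector_Spaces.linear "(*s)" "(*s)" ?f .
  obtain c :: "'a^'n \<Rightarrow> 'a" where c: "Vector_Spaces.linear (*s) (*) c" "c v = 1"
    and c0: "\<And>x. x \<in> ?f ` V \<Longrightarrow> c x = 0"
    using ex_linear_functional[OF f.subspace_image[OF V(1)] v(2)] by metis
  interpret c: Vector_Spaces.linear "(*s)" "(*)" c by fact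
  have cM: "c (M *v x) = \<mu> * c x" if "x \<in> V" for x
    using c0[of "?f x"] that by (simp add: c.diff c.scale)
  have sub: "vec.subspace (V \<inter> {x. c x = 0})"
    using V(1) c.subspace_kernel by (rule vec.subspace_inter)
  have "V \<inter> {x. c x = 0} \<subset> V"
    using v(1) c(2) by (metis (mono_tags, lifting) IntE inf_le1 mem_Collect_eq psubsetI zero_neq_one)
  then have "vec.dim (V \<inter> {x. c x = 0}) < vec.dim V"
    using vec.dim_psubset[of "V \<inter> {x. c x = 0}" V] vec.span_eq_iff[THEN iffD2, OF sub]
      vec.span_eq_iff[THEN iffD2, OF V(1)] by metis
  with c cM sub V show ?thesis by (intro that[of c]) auto
qed

text \<open>Young's inequality: the gap between \<open>r\<close> and \<open>s\<close> pays for the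
  cross term. With \<open>d\<close> the difference of their squares, the two sides differ by the
  square of \<open>d * a - r * b\<close> over \<open>d\<close>.\<close>

lemma sum_power2_le:
  fixes a b r s :: real
  assumes "0 \<le> r" "r < s"
  shows "(r * a + b)\<^sup>2 \<le> s\<^sup>2 * a\<^sup>2 + (s\<^sup>2 / (s\<^sup>2 - r\<^sup>2)) * b\<^sup>2"
proof -
  define d where "d = s\<^sup>2 - r\<^sup>2"
  have d: "d > 0" using assms by (simp add: d_def power_strict_mono)
  have "0 \<le> (d * a - r * b)\<^sup>2 / d" using d by simp
  also have "\<dots> = s\<^sup>2 * a\<^sup>2 + (s\<^sup>2 / d) * b\<^sup>2 - (r * a + b)\<^sup>2"
  proof -
    have s: "s\<^sup>2 = d + r\<^sup>2" by (simp add: d_def)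
    show ?thesis unfolding s using d by (simp add: field_simps power2_eq_square)
  qed
  finally show ?thesis by (simp add: d_def)
qed

text \<open>Induction on the dimension. An eigenvalue makes \<open>M\<close> minus \<mu>
  non-surjective on \<open>V\<close>, which yields an invariant hyperplane. In the splitting along
  \<open>v\<close> the map is block triangular, and a large weight on \<open>v\<close> makes the
  off-diagonal part negligible. The uniform factor \<rho> below 1 is the slack that the next
  dimension consumes.\<close>

lemma ex_strictly_contracting_norm:
  fixes M :: "complex^'n^'n"
  assumes "vec.subspace V" "\<And>x. x \<in> V \<Longrightarrow> M *v x \<in> V"
    and "\<And>\<mu> w. w \<in> V \<Longrightarrow> w \<noteq> 0 \<Longrightarrow> M *v w = \<mu> *s w \<Longrightarrow> cmod \<mu> < 1"
  shows "\<exists>T \<rho>. Vector_Spaces.linear (*s) (*s) T \<and> inj T \<and> 0 \<le> \<rho> \<and> \<rho> < 1 \<and>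
    (\<forall>x\<in>V. norm (T (M *v x) :: complex^'n) \<le> \<rho> * norm (T x))"
  using assms
proof (induction "vec.dim V" arbitrary: V rule: less_induct)
  case less
  show ?case
  proof (cases "V = {0}")
    case True
    then show ?thesis using linear_vec_id by (intro exI[of _ id] exI[of _ 0]) auto
  next
    case False
    then obtain \<mu> w where w: "w \<in> V" "w \<noteq> 0" "M *v w = \<mu> *s w"
      using ex_eigenvector_in_subspace[OF less.prems(1,2)] by metis
    let ?f = "\<lambda>x. M *v x - \<mu> *s x"
    have f: "Vector_Spaces.linear (*s) (*s) ?f"
      by (rule linear_mat_vec_minus_scalar_mult)
    have "?f ` V \<noteq> V" using image_proper_of_kernel[OF less.prems(1) f w(1,2)] w(3) by simp
    moreover have "?f ` V \<subseteq> V"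
      using less.prems(1,2) by (auto intro!: vec.subspace_diff vec.subspace_scale)
    ultimately obtain v where v: "v \<in> V" "v \<notin> ?f ` V" by blast
    obtain c where c: "Vector_Spaces.linear (*s) (*) c" "c v = 1"
      and cM: "\<And>x. x \<in> V \<Longrightarrow> c (M *v x) = \<mu> * c x"
      and W: "vec.subspace (V \<inter> {x. c x = 0})" "vec.dim (V \<inter> {x. c x = 0}) < vec.dim V"
      "\<And>x. x \<in> V \<inter> {x. c x = 0} \<Longrightarrow> M *v x \<in> V \<inter> {x. c x = 0}"
      by (rule invariant_hyperplane[OF less.prems(1,2) v]) (assumption, rule that)
    interpret c: Vector_Spaces.linear "(*s)" "(*)" c by fact
    obtain T \<rho> where T: "Vector_Spaces.linear (*s) (*s) T" "inj T" and \<rho>: "0 \<le> \<rho>" "\<rho> < 1"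
      and contr: "\<And>x. x \<in> V \<Longrightarrow> c x = 0 \<Longrightarrow> norm (T (M *v x) :: complex^'n) \<le> \<rho> * norm (T x)"
      using less.hyps[OF W(2,1,3)] less.prems(3) by fastforce
    interpret T: Vector_Spaces.linear "(*s)" "(*s)" T by fact
    have \<mu>: "cmod \<mu> < 1" using less.prems(3) w by blast
    \<comment> \<open>The new contraction factor: exceeding \<rho> leaves room for the off-diagonal
      part, exceeding \<open>cmod \<mu>\<close> makes the gap below positive.\<close>
    obtain \<sigma> where \<sigma>: "max \<rho> (cmod \<mu>) < \<sigma>" "\<sigma> < 1"
      using dense[of "max \<rho> (cmod \<mu>)" 1] \<mu> \<rho> by auto
    then have \<sigma>0: "\<sigma> > 0" "\<rho> < \<sigma>" "cmod \<mu> < \<sigma>" using \<rho> by auto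
    \<comment> \<open>\<open>u\<close> is the off-diagonal part of \<open>M\<close> at
      \<open>v\<close>, and \<open>D\<close> is its price according to Young's inequality.\<close>
    define u where "u = M *v v - \<mu> *s v"
    define D where "D = (\<sigma>\<^sup>2 / (\<sigma>\<^sup>2 - \<rho>\<^sup>2)) * (norm (T u))\<^sup>2"
    have gap: "\<sigma>\<^sup>2 - (cmod \<mu>)\<^sup>2 > 0" using \<sigma>0 by (simp add: power_strict_mono)
    have D: "D \<ge> 0" using \<sigma>0 \<rho> by (simp add: D_def power_mono)
    \<comment> \<open>Chosen so that \<open>K\<^sup>2 * \<sigma>\<^sup>2\<close> dominates
      \<open>D + K\<^sup>2 * (cmod \<mu>)\<^sup>2\<close>; the summand 1 keeps \<open>K\<close>
      positive when \<open>D = 0\<close>.\<close>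
    define K where "K = sqrt ((D + 1) / (\<sigma>\<^sup>2 - (cmod \<mu>)\<^sup>2))"
    have K: "K > 0" "K\<^sup>2 * (\<sigma>\<^sup>2 - (cmod \<mu>)\<^sup>2) = D + 1"
      using gap D by (simp_all add: K_def)
    obtain T' where T': "Vector_Spaces.linear (*s) (*s) T'" "inj T'"
      and sq: "\<And>x. (norm (T' x :: complex^'n))\<^sup>2 = (norm (T (x - c x *s v)))\<^sup>2 + K\<^sup>2 * (cmod (c x))\<^sup>2"
      by (rule extend_norm_from_hyperplane[OF T c K(1)]) (rule that)
    have "norm (T' (M *v x)) \<le> \<sigma> * norm (T' x)" if x: "x \<in> V" for x
    proof -
      define y where "y = x - c x *s v"
      have y: "y \<in> V" "c y = 0"
        using x v(1) less.prems(1) by (auto simp: y_def c.diff c.scale c(2) intro!: vec.subspace_diff vec.subspace_scale)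
      have "M *v x - c (M *v x) *s v = M *v y + c x *s u"
        by (simp add: cM x y_def u_def matrix_vector_mult_diff_distrib vec.scale
            vec.scale_right_diff_distrib mult.commute)
      then have "norm (T (M *v x - c (M *v x) *s v)) = norm (T (M *v y) + c x *s T u)"
        by (simp add: T.add T.scale)
      also have "\<dots> \<le> \<rho> * norm (T y) + cmod (c x) * norm (T u)"
        using norm_triangle_ineq[of "T (M *v y)" "c x *s T u"] contr[OF y]
        by (simp add: norm_vector_scalar_mult)
      finally have "(norm (T (M *v x - c (M *v x) *s v)))\<^sup>2 \<le> (\<rho> * norm (T y) + cmod (c x) * norm (T u))\<^sup>2"
        by (rule power_mono) simp
      also have "\<dots> \<le> \<sigma>\<^sup>2 * (norm (T y))\<^sup>2 + D * (cmod (c x))\<^sup>2"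
        using sum_power2_le[OF \<rho>(1) \<sigma>0(2), of "norm (T y)" "cmod (c x) * norm (T u)"]
        by (simp add: D_def power_mult_distrib mult_ac)
      finally have "(norm (T' (M *v x)))\<^sup>2 \<le>
          \<sigma>\<^sup>2 * (norm (T y))\<^sup>2 + (D + K\<^sup>2 * (cmod \<mu>)\<^sup>2) * (cmod (c x))\<^sup>2"
        by (simp add: sq cM x norm_mult power_mult_distrib algebra_simps)
      also have "\<dots> \<le> \<sigma>\<^sup>2 * (norm (T y))\<^sup>2 + (K\<^sup>2 * \<sigma>\<^sup>2) * (cmod (c x))\<^sup>2"
        using K(2) by (intro add_left_mono mult_right_mono) (simp_all add: algebra_simps)
      also have "\<dots> = (\<sigma> * norm (T' x))\<^sup>2"
        by (simp add: sq y_def power_mult_distrib algebra_simps)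
      finally show ?thesis
        by (rule power2_le_imp_le) (use \<sigma>0(1) in simp)
    qed
    then show ?thesis using T' \<sigma>(2) \<sigma>0(1) by (intro exI[of _ T'] exI[of _ \<sigma>]) auto
  qed
qed

text \<open>A unimodular eigenvalue leaves no slack, so the off-diagonal part has to vanish: the
  eigenvector itself must complement the hyperplane. The last assumption is semisimplicity, which
  permits this choice. Once no such eigenvalue is left in \<open>V\<close>, the strict case
  applies.\<close>

lemma ex_contracting_norm:
  fixes M :: "complex^'n^'n"
  assumes "vec.subspace V" "\<And>x. x \<in> V \<Longrightarrow> M *v x \<in> V"
    and "\<And>\<mu> w. w \<in> V \<Longrightarrow> w \<noteq> 0 \<Longrightarrow> M *v w = \<mu> *s w \<Longrightarrow> cmod \<mu> \<le> 1"
    and "\<And>\<mu> x w. cmod \<mu> = 1 \<Longrightarrow> M *v w = \<mu> *s w \<Longrightarrow> M *v x - \<mu> *s x = w \<Longrightarrow> w = 0"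
  shows "\<exists>T. Vector_Spaces.linear (*s) (*s) T \<and> inj T \<and>
    (\<forall>x\<in>V. norm (T (M *v x) :: complex^'n) \<le> norm (T x))"
  using assms(1-3)
proof (induction "vec.dim V" arbitrary: V rule: less_induct)
  case less
  show ?case
  proof (cases "\<exists>\<mu> w. w \<in> V \<and> w \<noteq> 0 \<and> M *v w = \<mu> *s w \<and> cmod \<mu> = 1")
    case False
    then have "cmod \<mu> < 1" if "w \<in> V" "w \<noteq> 0" "M *v w = \<mu> *s w" for \<mu> w
      using less.prems(3) that by (meson less_eq_real_def)
    then obtain T \<rho> where T: "Vector_Spaces.linear (*s) (*s) T" "inj T" "\<rho> < 1"
      "\<And>x. x \<in> V \<Longrightarrow> norm (T (M *v x) :: complex^'n) \<le> \<rho> * norm (T x)"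
      using ex_strictly_contracting_norm[OF less.prems(1,2)] by metis
    have "norm (T (M *v x)) \<le> norm (T x)" if "x \<in> V" for x
      using T(4)[OF that] mult_right_mono[of \<rho> 1 "norm (T x)"] T(3) by simp
    with T show ?thesis by blast
  next
    case True
    then obtain \<mu> v where v: "v \<in> V" "v \<noteq> 0" "M *v v = \<mu> *s v" and \<mu>: "cmod \<mu> = 1" by blast
    \<comment> \<open>By semisimplicity an eigenvector for \<mu> is never in the image of
      \<open>M\<close> minus \<mu>.\<close>
    have v': "v \<notin> (\<lambda>x. M *v x - \<mu> *s x) ` V" using assms(4)[OF \<mu> v(3)] v(2) by blast
    obtain c where c: "Vector_Spaces.linear (*s) (*) c" "c v = 1"
      and cM: "\<And>x. x \<in> V \<Longrightarrow> c (M *v x) = \<mu> * c x"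
      and W: "vec.subspace (V \<inter> {x. c x = 0})" "vec.dim (V \<inter> {x. c x = 0}) < vec.dim V"
      "\<And>x. x \<in> V \<inter> {x. c x = 0} \<Longrightarrow> M *v x \<in> V \<inter> {x. c x = 0}"
      by (rule invariant_hyperplane[OF less.prems(1,2) v(1) v']) (assumption, rule that)
    interpret c: Vector_Spaces.linear "(*s)" "(*)" c by fact
    obtain T where T: "Vector_Spaces.linear (*s) (*s) T" "inj T"
      and contr: "\<And>x. x \<in> V \<Longrightarrow> c x = 0 \<Longrightarrow> norm (T (M *v x) :: complex^'n) \<le> norm (T x)"
      using less.hyps[OF W(2,1,3)] less.prems(3) by fastforce
    obtain T' where T': "Vector_Spaces.linear (*s) (*s) T'" "inj T'"
      and sq: "\<And>x. (norm (T' x :: complex^'n))\<^sup>2 = (norm (T (x - c x *s v)))\<^sup>2 + 1\<^sup>2 * (cmod (c x))\<^sup>2"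
      by (rule extend_norm_from_hyperplane[OF T c zero_less_one]) (rule that)
    have "norm (T' (M *v x)) \<le> norm (T' x)" if x: "x \<in> V" for x
    proof -
      define y where "y = x - c x *s v"
      have y: "y \<in> V" "c y = 0"
        using x v(1) less.prems(1) by (auto simp: y_def c.diff c.scale c(2) intro!: vec.subspace_diff vec.subspace_scale)
      \<comment> \<open>As \<open>v\<close> is an eigenvector, no multiple of an off-diagonal vector
        appears, and weight 1 suffices.\<close>
      have "M *v x - c (M *v x) *s v = M *v y"
        by (simp add: cM x y_def matrix_vector_mult_diff_distrib vec.scale v(3) mult.commute)
      then have "(norm (T' (M *v x)))\<^sup>2 \<le> (norm (T' x))\<^sup>2"
        using power_mono[OF contr[OF y] norm_ge_zero, of 2]
        by (simp add: sq cM x norm_mult \<mu> y_def)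
      then show ?thesis by (rule power2_le_imp_le) simp
    qed
    with T' show ?thesis by blast
  qed
qed

subsection \<open>Algebraic and geometric multiplicity\<close>

lemma det_nz_iff_trivial_kernel:
  "det N \<noteq> 0 \<longleftrightarrow> (\<forall>y. N *v y = 0 \<longrightarrow> y = 0)" for N :: "'a::field^'n^'n"
  by (simp add: invertible_det_nz[symmetric] invertible_left_inverse matrix_left_invertible_ker)

lemma mat_mult_vec: "mat x *v v = x *s v" for v :: "'a::semiring_1^'n"
  by (simp add: vec_eq_iff matrix_vector_mult_def mat_def if_distrib if_distribR cong: if_cong)

lemma poly_det: "poly (det X) x = det (\<chi> i j. poly (X $ i $ j) x)"
  for X :: "'a::comm_ring_1 poly^'n^'n"
  by (simp add: det_def poly_sum poly_prod)

lemma poly_char_poly_c: "poly (char_poly_c A) x = det (mat x - cmat A)"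
  unfolding char_poly_c_def poly_det by (rule arg_cong[of _ _ det]) (simp add: vec_eq_iff mat_def)

text \<open>It has no root at \<open>C + 1\<close>, where \<open>C\<close> bounds the operator norm.
  This makes its root orders meaningful.\<close>

lemma char_poly_c_nonzero: "char_poly_c A \<noteq> 0"
proof
  assume 0: "char_poly_c A = 0"
  have "bounded_linear ((*v) (cmat A))" by (rule matrix_vector_mul_bounded_linear)
  then obtain C where C: "C > 0" "\<And>v. norm (cmat A *v v) \<le> norm v * C"
    using bounded_linear.pos_bounded by blast
  have "det (mat (complex_of_real (C + 1)) - cmat A) = 0"
    using poly_char_poly_c[of A "complex_of_real (C + 1)"] 0 by simp
  then obtain v where v: "v \<noteq> 0" "(mat (complex_of_real (C + 1)) - cmat A) *v v = 0"
    using det_nz_iff_trivial_kernel by blast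
  then have "cmat A *v v = complex_of_real (C + 1) *s v"
    by (simp add: matrix_vector_mult_diff_rdistrib mat_mult_vec del: of_real_add)
  then have "(C + 1) * norm v \<le> norm v * C"
    using C(2)[of v] C(1) by (simp add: norm_vector_scalar_mult del: of_real_add)
  then show False using v(1) by (simp add: algebra_simps)
qed

text \<open>
  In a basis \<open>b\<close> extending a basis \<open>{b j | j \<in> K}\<close> of the eigenspace, the columns \<open>K\<close> of \<open>(x - M) P\<close> are
  \<open>(x - z) b j\<close>. Pulling out these factors leaves \<open>det (Q x)\<close>, and \<open>Q z\<close> is singular exactly if
  some generalized eigenvector is not an eigenvector.
\<close>

lemma alg_mult_eq_geom_mult_iff:
  fixes A :: "real^'n^'n"
  shows "alg_mult A z = geom_mult A z \<longleftrightarrow>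
    (\<forall>u w. cmat A *v u = z *s u \<longrightarrow> cmat A *v w - z *s w = u \<longrightarrow> u = 0)"
proof -
  let ?M = "cmat A"
  define E where "E = {v. ?M *v v = z *s v}"
  have E: "vec.subspace E"
    by (auto simp: vec.subspace_def E_def matrix_vector_right_distrib vec.scale_right_distrib
        vec.scale mult.commute)
  obtain B0 where B0: "B0 \<subseteq> E" "vec.independent B0" "E \<subseteq> vec.span B0" "card B0 = vec.dim E"
    by (rule vec.basis_exists[of E])
  obtain B where B: "B0 \<subseteq> B" "B \<subseteq> UNIV" "vec.independent B" "UNIV \<subseteq> vec.span B"
    by (rule vec.maximal_independent_subset_extend[OF subset_UNIV B0(2)])
  have fB: "finite B" using B(3) by (rule vec.finiteI_independent)
  have "card B = vec.dim (UNIV :: (complex^'n) set)"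
    by (rule vec.basis_card_eq_dim) (use B in auto)
  then have "card (UNIV :: 'n set) = card B" by (simp add: card_cart_basis)
  then obtain b where b: "bij_betw b (UNIV :: 'n set) B"
    using finite_same_card_bij[OF finite fB] by blast
  define K where "K = {j. b j \<in> B0}"
  have bK: "bij_betw b K B0"
    using b B(1) unfolding bij_betw_def K_def by (auto intro: inj_on_subset)
  have cardK: "card K = vec.dim E" using bij_betw_same_card[OF bK] B0(4) by simp
  have bE: "?M *v b j = z *s b j" if "j \<in> K" for j
    using that B0(1) by (auto simp: K_def E_def)
  have E_repr: "\<exists>t. u = (\<Sum>j\<in>K. t j *s b j)" if u: "u \<in> E" for u
  proof -
    have "finite B0" using B0(2) by (rule vec.finiteI_independent)
    then obtain s where "u = (\<Sum>v\<in>B0. s v *s v)"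
      using subsetD[OF B0(3) u] by (auto simp: vec.span_finite)
    then have "u = (\<Sum>j\<in>K. s (b j) *s b j)"
      using sum.reindex_bij_betw[OF bK, of "\<lambda>v. s v *s v"] by simp
    then show ?thesis by (rule exI[where x = "\<lambda>j. s (b j)"])
  qed
  define P :: "complex^'n^'n" where "P = (\<chi> i j. b j $ i)"
  have colP: "column j P = b j" for j by (simp add: P_def column_def vec_eq_iff)
  have "columns P = B" using b by (auto simp: columns_def colP bij_betw_def)
  then have "invertible P"
    using matrix_right_invertible_span_columns[of P] B(4) by (auto simp: invertible_right_inverse)
  then have detP: "det P \<noteq> 0" by (simp add: invertible_det_nz)
  define a where "a y = (\<Sum>j\<in>K. y $ j *s b j)" for y
  define r where "r y = (\<Sum>j\<in>-K. y $ j *s b j)" for y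
  have split: "(\<Sum>j\<in>UNIV. f j) = (\<Sum>j\<in>K. f j) + (\<Sum>j\<in>-K. f j)" for f :: "'n \<Rightarrow> complex^'n"
    using sum.union_disjoint[of K "- K" f] by (simp add: Compl_partition)
  have Py: "P *v y = a y + r y" for y
    by (simp add: matrix_mult_sum colP split a_def r_def)
  have ker: "y = 0" if "a y + r y = 0" for y
    using that detP Py[of y] unfolding det_nz_iff_trivial_kernel by metis
  have aE: "?M *v a y = z *s a y" for y
    unfolding a_def vec.sum vec.scale_sum_right
    by (intro sum.cong refl) (simp add: vec.scale bE mult.commute)
  define Q where "Q x = (\<chi> i j. if j \<in> K then b j $ i else ((mat x - ?M) *v b j) $ i)" for x
  have colQ: "column j (Q x) = (if j \<in> K then b j else (mat x - ?M) *v b j)" for j x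
    by (simp add: Q_def column_def vec_eq_iff)
  have Qy: "Q z *v y = a y + (z *s r y - ?M *v r y)" for y
  proof -
    have "Q z *v y = (\<Sum>j\<in>UNIV. y $ j *s column j (Q z))" by (rule matrix_mult_sum)
    also have "\<dots> = a y + (\<Sum>j\<in>-K. y $ j *s ((mat z - ?M) *v b j))"
      by (simp add: split colQ a_def)
    also have "\<dots> = a y + (mat z - ?M) *v r y"
      by (simp only: r_def vec.sum vec.scale)
    finally have "Q z *v y = a y + (mat z - ?M) *v r y" .
    then show ?thesis by (simp add: matrix_vector_mult_diff_rdistrib mat_mult_vec)
  qed
  \<comment> \<open>The determinant of \<open>Q x\<close> as a polynomial in \<open>x\<close>: the
    columns outside \<open>K\<close> are linear in \<open>x\<close>, the others constant.\<close>
  define q where "q = det (\<chi> i j. if j \<in> K then [:b j $ i:] else [:- (?M *v b j) $ i, b j $ i:])"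
  have q: "poly q x = det (Q x)" for x
    unfolding q_def poly_det Q_def
    by (rule arg_cong[of _ _ det])
      (simp add: vec_eq_iff matrix_vector_mult_diff_rdistrib mat_mult_vec)
  have "poly (smult (det P) (char_poly_c A)) x = poly ([:- z, 1:] ^ card K * q) x" for x
  proof -
    let ?c = "\<lambda>j. if j \<in> K then x - z else 1"
    \<comment> \<open>Transposed because the common factors are pulled out of rows.\<close>
    have "(mat x - ?M) ** P = transpose (\<chi> j. ?c j *s column j (Q x))"
    proof -
      have "column j ((mat x - ?M) ** P) = ?c j *s column j (Q x)" for j
      proof -
        have "column j ((mat x - ?M) ** P) = (mat x - ?M) *v b j"
          by (simp add: vec_eq_iff column_def matrix_matrix_mult_def matrix_vector_mult_def P_def)
        then show ?thesis
          by (simp add: colQ bE matrix_vector_mult_diff_rdistrib mat_mult_vec vec.scale_left_diff_distrib)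
      qed
      then show ?thesis by (simp add: vec_eq_iff transpose_def column_def)
    qed
    then have "det (mat x - ?M) * det P = det (\<chi> j. ?c j *s column j (Q x))"
      by (metis det_mul det_transpose)
    also have "\<dots> = (\<Prod>j\<in>UNIV. ?c j) * det (\<chi> j. column j (Q x))"
      by (rule det_rows_mul)
    also have "(\<Prod>j\<in>UNIV. ?c j) = (x - z) ^ card K"
      by (simp add: prod.If_cases)
    also have "(\<chi> j. column j (Q x)) = transpose (Q x)"
      by (simp add: vec_eq_iff transpose_def column_def)
    finally show ?thesis
      by (simp add: poly_char_poly_c q det_transpose mult.commute)
  qed
  then have pq: "smult (det P) (char_poly_c A) = [:- z, 1:] ^ card K * q"
    by (intro poly_eq_poly_eq_iff[THEN iffD1] ext)
  have ne: "[:- z, 1:] ^ card K * q \<noteq> 0"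
    using char_poly_c_nonzero[of A] detP by (simp flip: pq)
  have "alg_mult A z = order z (smult (det P) (char_poly_c A))"
    using detP by (simp add: alg_mult_def order_smult)
  also have "\<dots> = card K + order z q"
    unfolding pq using order_mult[OF ne] by (simp add: order_power_n_n)
  finally have "alg_mult A z = geom_mult A z \<longleftrightarrow> order z q = 0"
    by (simp add: cardK geom_mult_def E_def)
  also have "\<dots> \<longleftrightarrow> (\<forall>y. Q z *v y = 0 \<longrightarrow> y = 0)"
    using ne order_root[of q z] by (auto simp: q simp flip: det_nz_iff_trivial_kernel)
  also have "\<dots> \<longleftrightarrow> (\<forall>u w. ?M *v u = z *s u \<longrightarrow> ?M *v w - z *s w = u \<longrightarrow> u = 0)"
  proof (intro iffI allI impI)
    fix u w
    assume inj: "\<forall>y. Q z *v y = 0 \<longrightarrow> y = 0" and u: "?M *v u = z *s u" and w: "?M *v w - z *s w = u"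
    obtain t where t: "u = (\<Sum>j\<in>K. t j *s b j)" using E_repr[of u] u by (auto simp: E_def)
    obtain y where y: "w = a y + r y"
      using detP by (metis Py invertible_det_nz invertible_right_inverse matrix_vector_mul_assoc matrix_vector_mul_lid)
    \<comment> \<open>Replacing the eigenspace coordinates of \<open>w\<close> by those of
      \<open>u\<close> gives a kernel vector of \<open>Q z\<close>, since \<open>w\<close> and
      \<open>r y\<close> have the same image \<open>u\<close> under \<open>?M\<close> minus
      \<open>z\<close>.\<close>
    define y' where "y' = (\<chi> j. if j \<in> K then t j else y $ j)"
    have "a y' = u" "r y' = r y" by (simp_all add: a_def r_def y'_def t)
    moreover have "?M *v r y - z *s r y = u"
      using w aE[of y] by (simp add: y matrix_vector_right_distrib vec.scale_right_distrib)
    ultimately have "Q z *v y' = 0" by (simp add: Qy algebra_simps)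
    then have "y' = 0" using inj by blast
    then show "u = 0" using \<open>a y' = u\<close> by (simp add: a_def)
  next
    fix y
    assume ss: "\<forall>u w. ?M *v u = z *s u \<longrightarrow> ?M *v w - z *s w = u \<longrightarrow> u = 0" and "Q z *v y = 0"
    then have "?M *v r y - z *s r y = a y" by (simp add: Qy algebra_simps)
    \<comment> \<open>\<open>a y\<close> is an eigenvector and also in the image of
      \<open>?M\<close> minus \<open>z\<close>.\<close>
    then have a0: "a y = 0" using ss aE by blast
    then have "r y \<in> E" using \<open>?M *v r y - z *s r y = a y\<close> by (simp add: E_def)
    then obtain t where t: "r y = (\<Sum>j\<in>K. t j *s b j)" using E_repr by blast
    \<comment> \<open>Now \<open>r y\<close> is a combination of the basis vectors in
      \<open>K\<close> as well as of those outside \<open>K\<close>; the difference of the two is a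
      relation, so it is trivial.\<close>
    define y' where "y' = (\<chi> j. if j \<in> K then - t j else y $ j)"
    have "a y' = - r y" "r y' = r y"
      by (simp_all add: a_def r_def y'_def t sum_negf vec.scale_minus_left flip: t)
    then have "a y' + r y' = 0" by simp
    then have "y' = 0" by (rule ker)
    have "r y = 0" using \<open>y' = 0\<close> \<open>r y' = r y\<close> by (simp add: r_def)
    show "y = 0" by (rule ker) (simp add: a0 \<open>r y = 0\<close>)
  qed
  finally show ?thesis .
qed


subsection \<open>Stability and contractions\<close>

lemma cmat_mult: "cmat (A ** B) = cmat A ** cmat B"
  by (simp add: cmat_def matrix_matrix_mult_def vec_eq_iff)

lemma cmat_1: "cmat (mat 1) = mat 1"
  by (simp add: cmat_def mat_def vec_eq_iff)

definition cvec :: "real^'n \<Rightarrow> complex^'n" where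
  "cvec x = (\<chi> i. complex_of_real (x $ i))"

lemma linear_cvec: "linear cvec"
  by (rule linearI) (simp_all add: cvec_def vec_eq_iff, simp add: scaleR_conv_of_real)

lemma cvec_eq_0_iff [simp]: "cvec x = 0 \<longleftrightarrow> x = 0"
  by (simp add: cvec_def vec_eq_iff)

lemma cmat_mult_cvec: "cmat A *v cvec x = cvec (A *v x)"
  by (simp add: cmat_def cvec_def matrix_vector_mult_def vec_eq_iff)

lemma norm_complex_vec:
  "(norm z)\<^sup>2 = (norm (\<chi> i. Re (z $ i)))\<^sup>2 + (norm (\<chi> i. Im (z $ i)))\<^sup>2" for z :: "complex^'n"
  by (simp add: power2_norm_eq_inner inner_vec_def inner_complex_def sum.distrib)

text \<open>A real matrix acts separately on real and imaginary parts, whose squared norms add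
  up.\<close>

lemma norm_cmat_mult_le:
  assumes C: "\<And>x. norm (C *v x) \<le> norm x"
  shows "norm (cmat C *v z) \<le> norm z"
proof -
  have "(\<chi> i. Re ((cmat C *v z) $ i)) = C *v (\<chi> i. Re (z $ i))"
    "(\<chi> i. Im ((cmat C *v z) $ i)) = C *v (\<chi> i. Im (z $ i))"
    by (simp_all add: cmat_def matrix_vector_mult_def)
  then have "(norm (cmat C *v z))\<^sup>2 \<le> (norm z)\<^sup>2"
    unfolding norm_complex_vec by (auto intro!: add_mono power_mono C)
  then show ?thesis by (rule power2_le_imp_le) simp
qed

lemma stable_if_similar_to_contraction:
  fixes A S C :: "real^'n^'n"
  assumes S: "invertible S" and C: "\<And>x. norm (C *v x) \<le> norm x" and SA: "S ** A = C ** S"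
  shows "stable A"
proof -
  let ?M = "cmat A" and ?N = "\<lambda>v. norm (cmat S *v v)"
  obtain S' where "S' ** S = mat 1" using S invertible_left_inverse by blast
  then have "cmat S' ** cmat S = mat 1" by (metis cmat_1 cmat_mult)
  then have N0: "v = 0" if "?N v = 0" for v
    using that by (metis matrix_vector_mul_assoc matrix_vector_mul_lid matrix_vector_mult_0_right norm_eq_zero)
  have contr: "?N (?M *v v) \<le> ?N v" for v
  proof -
    have "cmat S *v (?M *v v) = cmat C *v (cmat S *v v)"
      by (simp add: matrix_vector_mul_assoc SA flip: cmat_mult)
    then show ?thesis using norm_cmat_mult_le[OF C] by simp
  qed
  have scale: "?N (c *s v) = cmod c * ?N v" for c v
    by (simp add: vec.scale norm_vector_scalar_mult)
  show ?thesis
    unfolding stable_def is_eigenvalue_def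
  proof (intro allI impI conjI)
    fix z assume "\<exists>v. v \<noteq> 0 \<and> ?M *v v = z *s v"
    then obtain v where v: "v \<noteq> 0" "?M *v v = z *s v" by blast
    then have "cmod z * ?N v \<le> ?N v" using contr[of v] by (simp add: scale)
    moreover have "?N v > 0" using N0 v(1) by (metis norm_eq_zero zero_less_norm_iff)
    ultimately show "cmod z \<le> 1" by simp
  next
    fix z assume z: "cmod z = 1"
    have "u = 0" if u: "?M *v u = z *s u" and w: "?M *v w - z *s w = u" for u w
    proof -
      have Mw: "?M *v w = z *s w + u" using w by (simp add: algebra_simps)
      \<comment> \<open>The orbit of \<open>w\<close>, starting at \<open>?M *v w\<close> so that no
        exponent \<open>k - 1\<close> is needed.\<close>
      define x where "x k = z ^ Suc k *s w + (of_nat (Suc k) * z ^ k) *s u" for k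
      have x_Suc: "?M *v x k = x (Suc k)" for k
      proof -
        have "?M *v x k = z ^ Suc k *s (z *s w + u) + (of_nat (Suc k) * z ^ k) *s (z *s u)"
          by (simp only: x_def matrix_vector_right_distrib vec.scale Mw u)
        also have "\<dots> = (z ^ Suc k * z) *s w + (z ^ Suc k + of_nat (Suc k) * z ^ k * z) *s u"
          by (simp only: vec.scale_right_distrib vec.scale_left_distrib vec.scale_scale add.assoc)
        also have "z ^ Suc k * z = z ^ Suc (Suc k)" by simp
        also have "z ^ Suc k + of_nat (Suc k) * z ^ k * z = of_nat (Suc (Suc k)) * z ^ Suc k"
          by (simp add: algebra_simps)
        finally show ?thesis by (simp only: x_def)
      qed
      have x_le: "?N (x k) \<le> ?N w" for k
      proof (induction k)
        case 0
        then show ?case using contr[of w] by (simp add: x_def Mw)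
      next
        case (Suc k)
        then show ?case using contr[of "x k"] by (simp add: x_Suc)
      qed
      have "real k * ?N u \<le> 2 * ?N w" for k
      proof (cases k)
        case (Suc j)
        have "real k * ?N u = ?N ((of_nat (Suc j) * z ^ j) *s u)"
          by (simp only: scale norm_mult norm_power z Suc norm_of_nat) simp
        also have "(of_nat (Suc j) * z ^ j) *s u = x j - z ^ Suc j *s w" by (simp add: x_def)
        also have "?N \<dots> \<le> ?N (x j) + ?N (z ^ Suc j *s w)"
          unfolding matrix_vector_mult_diff_distrib by (rule norm_triangle_ineq4)
        also have "?N (z ^ Suc j *s w) = ?N w" by (simp only: scale norm_power z) simp
        finally show ?thesis using x_le[of j] by simp
      qed simp
      then have "?N u = 0"
        by (metis norm_ge_zero not_less order_less_le reals_Archimedean3)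
      then show "u = 0" by (rule N0)
    qed
    then show "alg_mult A z = geom_mult A z" by (simp add: alg_mult_eq_geom_mult_iff)
  qed
qed

text \<open>The contracted complex norm, pulled back to real vectors, comes from an injective
  real-linear \<open>f\<close>. Its range has real dimension \<open>CARD('n)\<close>, so a linear
  isometry carries it to \<open>real^'n\<close> and turns \<open>f\<close> into a real
  matrix.\<close>

lemma similar_to_contraction_if_stable:
  fixes A :: "real^'n^'n"
  assumes "stable A"
  obtains S :: "real^'n^'n" where "invertible S" "\<And>x. norm (S *v (A *v x)) \<le> norm (S *v x)"
proof -
  have le: "cmod \<mu> \<le> 1" if "w \<noteq> 0" "cmat A *v w = \<mu> *s w" for \<mu> w
    using assms that unfolding stable_def is_eigenvalue_def by blast
  have ss: "w = 0"
    if "cmod \<mu> = 1" "cmat A *v w = \<mu> *s w" "cmat A *v x - \<mu> *s x = w" for \<mu> x w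
  proof (rule ccontr)
    assume "w \<noteq> 0"
    then have "alg_mult A \<mu> = geom_mult A \<mu>"
      using assms that unfolding stable_def is_eigenvalue_def by blast
    with that \<open>w \<noteq> 0\<close> show False unfolding alg_mult_eq_geom_mult_iff by blast
  qed
  have "\<exists>T. Vector_Spaces.linear (*s) (*s) T \<and> inj T \<and>
      (\<forall>x\<in>UNIV. norm (T (cmat A *v x) :: complex^'n) \<le> norm (T x))"
    by (rule ex_contracting_norm) (auto intro: le ss)
  then obtain T :: "complex^'n \<Rightarrow> complex^'n" where T: "Vector_Spaces.linear (*s) (*s) T" "inj T"
    and contr: "\<And>x. norm (T (cmat A *v x)) \<le> norm (T x)"
    by blast
  interpret T: Vector_Spaces.linear "(*s)" "(*s)" T by fact
  define f where "f x = T (cvec x)" for x :: "real^'n"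
  have scale: "cvec (r *\<^sub>R x) = complex_of_real r *s cvec x" for r and x :: "real^'n"
    by (simp add: cvec_def vec_eq_iff)
  have f: "linear f"
  proof (rule linearI)
    show "f (x + y) = f x + f y" for x y by (simp only: f_def linear_add[OF linear_cvec] T.add)
    show "f (r *\<^sub>R x) = r *\<^sub>R f x" for r x 
      unfolding f_def scale T.scale by (rule of_real_vector_scalar_mult)
  qed
  have f0: "x = 0" if "f x = 0" for x
    using that T(2) by (metis T.zero cvec_eq_0_iff f_def injD)
  then have "inj f" using linear_injective_0[OF f] by blast
  then have "dim (range f) = dim (UNIV :: (real^'n) set)"
    using dim_image_eq[OF f, of UNIV] by simp
  then obtain g :: "complex^'n \<Rightarrow> real^'n" where g: "linear g"
    and g_norm: "\<And>x. x \<in> range f \<Longrightarrow> norm (g x) = norm x"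
    using isometry_subspaces[OF linear_subspace_image[OF f subspace_UNIV] subspace_UNIV] by metis
  define S where "S = matrix (g \<circ> f)"
  have "linear (g \<circ> f)" using f g by (rule linear_compose)
  then have "S *v x = g (f x)" for x by (simp add: S_def matrix_works)
  then have S: "norm (S *v x) = norm (f x)" for x by (simp add: g_norm)
  then have "x = 0" if "S *v x = 0" for x
    using that f0 by (metis norm_eq_zero)
  then have "invertible S" by (simp add: invertible_left_inverse matrix_left_invertible_ker)
  moreover have "norm (S *v (A *v x)) \<le> norm (S *v x)" for x
    using contr[of "cvec x"] by (simp add: S f_def cmat_mult_cvec)
  ultimately show ?thesis by (rule that)
qed

section \<open>Inverses, spectral norm and the equivalence\<close>

lemma matrix_inv_mult:
  assumes "invertible A"
  shows "A ** matrix_inv A = mat 1" "matrix_inv A ** A = mat 1"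
  using someI_ex[OF assms[unfolded invertible_def]] by (auto simp: matrix_inv_def)

lemma spec_norm_le_1_iff: "spec_norm B \<le> 1 \<longleftrightarrow> (\<forall>x. norm (B *v x) \<le> norm x)"
proof
  assume *: "spec_norm B \<le> 1"
  show "\<forall>x. norm (B *v x) \<le> norm x"
  proof
    fix x
    have "norm (B *v x) \<le> spec_norm B * norm x"
      unfolding spec_norm_def by (rule onorm) simp
    also have "\<dots> \<le> 1 * norm x" using * by (intro mult_right_mono) auto
    finally show "norm (B *v x) \<le> norm x" by simp
  qed
next
  assume "\<forall>x. norm (B *v x) \<le> norm x"
  then show "spec_norm B \<le> 1" unfolding spec_norm_def by (intro onorm_le) simp
qed

lemma norm_orthogonal_matrix_mult: "orthogonal_matrix U \<Longrightarrow> norm (U *v x) = norm x"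
  for U :: "real^'n^'n"
  using orthogonal_transformation_matrix[of "(*v) U"] orthogonal_transformation_norm[of "(*v) U"]
  by simp

theorem theorem2:
  fixes A :: "real^'n^'n"
  shows "stable A \<longleftrightarrow>
    (\<exists>S U B :: real^'n^'n.
       invertible S \<and> transpose U ** U = mat 1 \<and>
       transpose B = B \<and> (\<forall>x. 0 \<le> x \<bullet> (B *v x)) \<and>
       spec_norm B \<le> 1 \<and>
       A = matrix_inv S ** U ** B ** S)"
proof
  assume "stable A"
  then obtain S :: "real^'n^'n" where S: "invertible S" and contr: "\<And>x. norm (S *v (A *v x)) \<le> norm (S *v x)"
    by (rule similar_to_contraction_if_stable) (rule that)
  have inv: "matrix_inv S ** S = mat 1" "S ** matrix_inv S = mat 1"
    using matrix_inv_mult[OF S] by auto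
  \<comment> \<open>\<open>S\<close> conjugates \<open>A\<close> to a contraction. Its polar factor
    \<open>B\<close> is a contraction too, because \<open>U\<close> preserves norms.\<close>
  obtain U B where U: "orthogonal_matrix U" and B: "transpose B = B" "\<And>x. 0 \<le> x \<bullet> (B *v x)"
    and UB: "S ** A ** matrix_inv S = U ** B"
    using polar_decomposition by metis
  have "norm (B *v x) \<le> norm x" for x
  proof -
    have "norm (B *v x) = norm (U *v (B *v x))" by (simp add: norm_orthogonal_matrix_mult U)
    also have "U *v (B *v x) = S *v (A *v (matrix_inv S *v x))"
      by (simp add: matrix_vector_mul_assoc matrix_mul_assoc flip: UB)
    also have "norm \<dots> \<le> norm (S *v (matrix_inv S *v x))" by (rule contr)
    also have "\<dots> = norm x" by (simp add: matrix_vector_mul_assoc inv)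
    finally show ?thesis .
  qed
  moreover have "A = matrix_inv S ** U ** B ** S"
  proof -
    have "matrix_inv S ** U ** B ** S = matrix_inv S ** (U ** B) ** S"
      by (simp add: matrix_mul_assoc)
    also have "\<dots> = (matrix_inv S ** S) ** A ** (matrix_inv S ** S)"
      by (simp only: UB[symmetric] matrix_mul_assoc)
    finally show ?thesis by (simp add: inv)
  qed
  ultimately show "\<exists>S U B :: real^'n^'n.
       invertible S \<and> transpose U ** U = mat 1 \<and>
       transpose B = B \<and> (\<forall>x. 0 \<le> x \<bullet> (B *v x)) \<and>
       spec_norm B \<le> 1 \<and>
       A = matrix_inv S ** U ** B ** S"
    using S U B by (auto simp: orthogonal_matrix spec_norm_le_1_iff)
next
  assume "\<exists>S U B :: real^'n^'n.
       invertible S \<and> transpose U ** U = mat 1 \<and>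
       transpose B = B \<and> (\<forall>x. 0 \<le> x \<bullet> (B *v x)) \<and>
       spec_norm B \<le> 1 \<and>
       A = matrix_inv S ** U ** B ** S"
  then obtain S U B :: "real^'n^'n" where S: "invertible S" and U: "orthogonal_matrix U"
    and B: "\<And>x. norm (B *v x) \<le> norm x" and A: "A = matrix_inv S ** U ** B ** S"
    by (auto simp: orthogonal_matrix spec_norm_le_1_iff)
  have "norm ((U ** B) *v x) \<le> norm x" for x
    using B by (simp add: norm_orthogonal_matrix_mult U flip: matrix_vector_mul_assoc)
  moreover have "S ** A = (U ** B) ** S"
    using S by (simp add: A matrix_mul_assoc matrix_inv_mult)
  ultimately show "stable A" by (rule stable_if_similar_to_contraction[OF S])
qed

end
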